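(* Let $G$ be a finitely generated, residually finite group. For a finitely generated group $H$ let $\operatorname{rk}(H)$ denote the minimal number of elements generating $H$ (every subgroup of finite index in $G$ is finitely generated). Suppose that the function $\varphi = \operatorname{rk} - 1$, defined on the subgroups of finite index in $G$, is multiplicative, i.e. for all subgroups $G_2 \leq G_1 \leq G$ with $G_2$ of finite index in $G$ one has \[ \operatorname{rk}(G_2) - 1 = [G_1 : G_2]\cdot\big(\operatorname{rk}(G_1) - 1\big). \] Then $G$ is a free group.
   Context: The rank $\operatorname{rk}(H)$ of a finitely generated group $H$ is the minimal cardinality of a generating set of $H$. A real-valued function $\varphi$ on the subgroups of finite index of $G$ is called multiplicative if $\varphi(G_2) = [G_1:G_2]\cdot \varphi(G_1)$ for all pairs of subgroups $G_2 \leq G_1$ of $G$ with $G_2$ of finite index in $G$. *)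

theory Defs
  imports "HOL-Algebra.Algebra"
begin

definition fin_gen_group :: "('a, 'b) monoid_scheme \<Rightarrow> bool" where
  "fin_gen_group G \<longleftrightarrow> (\<exists>S. finite S \<and> S \<subseteq> carrier G \<and> generate G S = carrier G)"

definition grp_rank :: "('a, 'b) monoid_scheme \<Rightarrow> 'a set \<Rightarrow> nat" where
  "grp_rank G H = (LEAST n. \<exists>S. finite S \<and> S \<subseteq> H \<and> card S = n \<and> generate G S = H)"

definition fin_index :: "('a, 'b) monoid_scheme \<Rightarrow> 'a set \<Rightarrow> bool" where
  "fin_index G H \<longleftrightarrow> finite (rcosets\<^bsub>G\<^esub> H)"

definition rel_index :: "('a, 'b) monoid_scheme \<Rightarrow> 'a set \<Rightarrow> 'a set \<Rightarrow> nat" where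
  "rel_index G K H = card (rcosets\<^bsub>G\<lparr>carrier := K\<rparr>\<^esub> H)"

definition residually_finite :: "('a, 'b) monoid_scheme \<Rightarrow> bool" where
  "residually_finite G \<longleftrightarrow>
     (\<forall>g \<in> carrier G. g \<noteq> \<one>\<^bsub>G\<^esub> \<longrightarrow>
        (\<exists>N. N \<lhd> G \<and> fin_index G N \<and> g \<notin> N))"

fun eval_word :: "('a, 'b) monoid_scheme \<Rightarrow> ('a \<times> bool) list \<Rightarrow> 'a" where
  "eval_word G [] = \<one>\<^bsub>G\<^esub>"
| "eval_word G ((x, False) # w) = x \<otimes>\<^bsub>G\<^esub> eval_word G w"
| "eval_word G ((x, True) # w) = inv\<^bsub>G\<^esub> x \<otimes>\<^bsub>G\<^esub> eval_word G w"

fun reduced_word :: "('a \<times> bool) list \<Rightarrow> bool" where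
  "reduced_word [] = True"
| "reduced_word [_] = True"
| "reduced_word ((x, b) # (y, c) # w) =
     (\<not> (x = y \<and> b \<noteq> c) \<and> reduced_word ((y, c) # w))"

definition free_basis :: "('a, 'b) monoid_scheme \<Rightarrow> 'a set \<Rightarrow> bool" where
  "free_basis G B \<longleftrightarrow> B \<subseteq> carrier G \<and> generate G B = carrier G \<and>
     (\<forall>w. w \<noteq> [] \<and> set (map fst w) \<subseteq> B \<and> reduced_word w \<longrightarrow> eval_word G w \<noteq> one G)"

definition free_group :: "('a, 'b) monoid_scheme \<Rightarrow> bool" where
  "free_group G \<longleftrightarrow> (\<exists>B. free_basis G B)"

end

theory Submission
  imports Defs
begin

text \<open>
  Let \<open>S\<close> be a generating set of minimal size \<open>n\<close>. If \<open>G\<close> is not free on \<open>S\<close>, a shortest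
  nontrivial relator traces a simple closed path in the Cayley graph of \<open>G\<close>. By residual finiteness
  its vertices stay distinct modulo some subgroup \<open>H\<close> of finite index \<open>d\<close>. Growing this cycle, one
  edge at a time, to a transversal \<open>P\<close> of \<open>H\<close> yields a set of \<open>d\<close> vertices that spans at least \<open>d\<close>
  edges, one more than a spanning tree would. The Schreier generators of those edges are
  trivial, so at most \<open>d * n - d\<close> of them are needed to generate \<open>H\<close>, whereas multiplicativity
  demands \<open>d * (n - 1) + 1\<close>.
\<close>

section \<open>Schreier generators\<close>

text \<open>Elements of \<open>generate G S\<close> are built by products, so the induction
  generalises over \<open>a\<close> and absorbs one factor after the other. \<open>A\<close> is a
  mere set because it will be a union of right cosets.\<close>

lemma (in group) generate_closed_right:
  assumes "S \<subseteq> carrier G" "A \<subseteq> carrier G"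
    and mult: "\<And>a s. a \<in> A \<Longrightarrow> s \<in> S \<Longrightarrow> a \<otimes> s \<in> A"
    and mult_inv: "\<And>a s. a \<in> A \<Longrightarrow> s \<in> S \<Longrightarrow> a \<otimes> inv s \<in> A"
    and "g \<in> generate G S" "a \<in> A"
  shows "a \<otimes> g \<in> A"
  using assms(5,6)
proof (induction arbitrary: a rule: generate.induct)
  case one
  then show ?case using assms(2) by auto
next
  case (incl h)
  then show ?case using mult by blast
next
  case (inv h)
  then show ?case using mult_inv by blast
next
  case (eng h1 h2)
  have "h1 \<in> carrier G" "h2 \<in> carrier G"
    using eng.hyps generate_in_carrier[OF assms(1)] by auto
  moreover have "a \<otimes> h1 \<otimes> h2 \<in> A"
    using eng by blast
  ultimately show ?case using eng.prems assms(2) by (metis m_assoc subsetD)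
qed

text \<open>The edges of the Cayley graph induced on \<open>P\<close>, each recorded by source and
  label: a step along \<open>inv s\<close> from \<open>q\<close> uses the pair
  \<open>(q \<otimes> inv s, s)\<close>.\<close>

definition (in group) inner_edges :: "'a set \<Rightarrow> 'a set \<Rightarrow> ('a \<times> 'a) set" where
  "inner_edges S P = {(p, s). p \<in> P \<and> s \<in> S \<and> p \<otimes> s \<in> P}"

lemma (in group) finite_inner_edges: "finite S \<Longrightarrow> finite P \<Longrightarrow> finite (inner_edges S P)"
  by (rule finite_subset[of _ "P \<times> S"]) (auto simp: inner_edges_def)

lemma (in group) rcos_eq_iff:
  assumes "subgroup H G" "x \<in> carrier G" "y \<in> carrier G"
  shows "H #> x = H #> y \<longleftrightarrow> x \<otimes> inv y \<in> H"
proof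
  assume "H #> x = H #> y"
  then have "x \<in> H #> y" using rcos_self[OF assms(2,1)] by simp
  then obtain h where "h \<in> H" "x = h \<otimes> y" by (auto simp: r_coset_def)
  then show "x \<otimes> inv y \<in> H"
    using assms subgroup.mem_carrier[OF assms(1)] by (simp add: m_assoc)
next
  assume *: "x \<otimes> inv y \<in> H"
  have "x = (x \<otimes> inv y) \<otimes> y" using assms by (simp add: m_assoc)
  then have "x \<in> H #> y" using * by (auto simp: r_coset_def)
  then show "H #> x = H #> y"
    using repr_independence[OF _ assms(3,1)] by simp
qed

lemma (in group) rcos_mult_right:
  assumes "subgroup H G" "x \<in> carrier G" "y \<in> carrier G" "z \<in> carrier G" "H #> x = H #> y"
  shows "H #> (x \<otimes> z) = H #> (y \<otimes> z)"
  using assms subgroup.subset[OF assms(1)] by (metis coset_mult_assoc)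

text \<open>With \<open>K\<close> the generated subgroup, the set \<open>K P\<close> contains 1 and
  is stable under right multiplication by \<open>S\<close> and its inverses, hence is all of
  \<open>G\<close>. For an element of \<open>H\<close> the factor from \<open>P\<close> must then be
  1. Inner edges can be left out because their Schreier generators are trivial.\<close>

lemma (in group) schreier_generators:
  assumes H: "subgroup H G" and S: "S \<subseteq> carrier G" "generate G S = carrier G"
    and P: "P \<subseteq> carrier G" "\<one> \<in> P"
    and r: "\<And>g. g \<in> carrier G \<Longrightarrow> r g \<in> P \<and> H #> r g = H #> g"
    and r_id: "\<And>p. p \<in> P \<Longrightarrow> r p = p"
    and r_cong: "\<And>g h. H #> g = H #> h \<Longrightarrow> r g = r h"
  shows "generate G ((\<lambda>(p, s). p \<otimes> s \<otimes> inv (r (p \<otimes> s))) ` (P \<times> S - inner_edges S P)) = H"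
    (is "generate G ?T = H")
proof -
  let ?K = "generate G ?T"
  have rc: "r g \<in> carrier G" if "g \<in> carrier G" for g using r[OF that] P by blast
  have gen_in_H: "p \<otimes> s \<otimes> inv (r (p \<otimes> s)) \<in> H" if "p \<in> P" "s \<in> S" for p s
  proof -
    have "p \<otimes> s \<in> carrier G" using that P S by blast
    then show ?thesis using rcos_eq_iff[OF H] r rc by metis
  qed
  then have "?T \<subseteq> H" by auto
  then have KH: "?K \<subseteq> H" using H by (rule generate_subgroup_incl)
  have Hc: "H \<subseteq> carrier G" by (rule subgroup.subset[OF H])
  have K: "subgroup ?K G"
    using \<open>?T \<subseteq> H\<close> Hc by (intro generate_is_subgroup) blast
  have in_K: "p \<otimes> s \<otimes> inv (r (p \<otimes> s)) \<in> ?K" if ps: "p \<in> P" "s \<in> S" for p s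
  proof (cases "p \<otimes> s \<in> P")
    case True
    then have "p \<otimes> s \<otimes> inv (r (p \<otimes> s)) = \<one>" using r_id P by auto
    then show ?thesis using subgroup.one_closed[OF K] by simp
  next
    case False
    then have "(p, s) \<in> P \<times> S - inner_edges S P"
      using ps by (auto simp: inner_edges_def)
    then show ?thesis by (intro generate.incl) force
  qed
  let ?A = "{g. \<exists>k\<in>?K. \<exists>p\<in>P. g = k \<otimes> p}"
  have Ac: "?A \<subseteq> carrier G" using KH Hc P by auto
  have A: "\<one> \<otimes> g \<in> ?A" if "g \<in> generate G S" for g
  proof (rule generate_closed_right[OF S(1) Ac _ _ that])
    fix a s assume "a \<in> ?A" and s: "s \<in> S"
    then obtain k p where kp: "k \<in> ?K" "p \<in> P" "a = k \<otimes> p" by blast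
    have c: "k \<in> carrier G" "p \<in> carrier G" "s \<in> carrier G"
      using kp s KH Hc P S by auto
    let ?q = "r (p \<otimes> s)"
    have q: "?q \<in> P" "?q \<in> carrier G" using r rc c by auto
    have "a \<otimes> s = (k \<otimes> (p \<otimes> s \<otimes> inv ?q)) \<otimes> ?q"
      using c q by (simp add: kp m_assoc)
    moreover have "k \<otimes> (p \<otimes> s \<otimes> inv ?q) \<in> ?K"
      using in_K[OF kp(2) s] kp(1) subgroup.m_closed[OF K] by blast
    ultimately show "a \<otimes> s \<in> ?A" using q by blast
    \<comment> \<open>The edge labelled \<open>s\<close> from the representative \<open>?t\<close>
      leads back to the coset of \<open>p\<close>; the inverse of its Schreier generator corrects
      the backward step.\<close>
    let ?t = "r (p \<otimes> inv s)"
    have t: "?t \<in> P" "?t \<in> carrier G" using r rc c by auto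
    have "H #> (?t \<otimes> s) = H #> (p \<otimes> inv s \<otimes> s)"
      using r c t by (intro rcos_mult_right[OF H]) auto
    also have "p \<otimes> inv s \<otimes> s = p" using c by (simp add: m_assoc)
    finally have rt: "r (?t \<otimes> s) = p" using r_cong r_id kp by metis
    have "inv (?t \<otimes> s \<otimes> inv p) \<in> ?K"
      using subgroup.m_inv_closed[OF K in_K[OF t(1) s]] unfolding rt .
    then have "k \<otimes> inv (?t \<otimes> s \<otimes> inv p) \<in> ?K"
      using kp(1) subgroup.m_closed[OF K] by blast
    moreover have "a \<otimes> inv s = (k \<otimes> inv (?t \<otimes> s \<otimes> inv p)) \<otimes> ?t"
      using c t by (simp add: kp m_assoc inv_mult_group)
    ultimately show "a \<otimes> inv s \<in> ?A" using t by blast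
  next
    show "\<one> \<in> ?A" using P(2) subgroup.one_closed[OF K] by force
  qed
  have "h \<in> ?K" if h: "h \<in> H" for h
  proof -
    have hc: "h \<in> carrier G" using h Hc by blast
    then have "h \<in> ?A" using A[of h] S(2) by (simp only: l_one)
    then obtain k p where kp: "k \<in> ?K" "p \<in> P" "h = k \<otimes> p" by blast
    have c: "k \<in> carrier G" "p \<in> carrier G" using kp KH Hc P by auto
    \<comment> \<open>Both \<open>p\<close> and 1 turn out to represent the trivial coset, so they
      agree.\<close>
    have "p = inv k \<otimes> h" using kp c by (simp add: m_assoc[symmetric])
    then have "p \<in> H"
      using subgroup.m_closed[OF H subgroup.m_inv_closed[OF H] h] kp(1) KH by auto
    then have "H #> p = H #> \<one>"
      using coset_join2[OF c(2) H] Hc by simp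
    then have "p = \<one>" using r_cong[of p \<one>] r_id kp P by simp
    then show ?thesis using kp c by simp
  qed
  then show ?thesis using KH by blast
qed

section \<open>Growing a partial transversal\<close>

text \<open>The generators connect all cosets, so while one is missed, some edge leads from a point
  of \<open>P\<close> to a new coset. Adding its far end costs one vertex and gains at least one
  inner edge, so the inequality survives.\<close>

lemma (in group) extend_partial_transversal:
  assumes H: "subgroup H G" and fin: "finite (rcosets H)"
    and S: "finite S" "S \<subseteq> carrier G" "generate G S = carrier G"
    and P: "P \<subseteq> carrier G" "P \<noteq> {}" "inj_on ((#>) H) P" "card P \<le> card (inner_edges S P)"
  obtains Q where "P \<subseteq> Q" "Q \<subseteq> carrier G" "inj_on ((#>) H) Q" "(#>) H ` Q = rcosets H"
    "card Q \<le> card (inner_edges S Q)"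
  using P
proof (induction "card (rcosets H) - card P" arbitrary: P thesis rule: less_induct)
  case less
  note P = less.prems(2-5)
  have sub: "(#>) H ` P \<subseteq> rcosets H" if "P \<subseteq> carrier G" for P
    using that by (auto simp: RCOSETS_def)
  have finP: "finite P"
    using P(3) sub[OF P(1)] fin by (metis finite_imageD finite_subset)
  show ?case
  proof (cases "(#>) H ` P = rcosets H")
    case True
    then show ?thesis using less.prems by blast
  next
    case False
    have grow: thesis
      if g: "g \<in> carrier G" "H #> g \<notin> (#>) H ` P"
        and e: "e \<notin> inner_edges S P" "e \<in> inner_edges S (insert g P)" for g e
    proof (rule less.hyps[of "insert g P"])
      have gP: "g \<notin> P" using g(2) by blast
      show "inj_on ((#>) H) (insert g P)" using P(3) g(2) gP by auto
      \<comment> \<open>The enlarged set still injects into the cosets, so \<open>card P\<close> is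
        below their number and the truncated difference really drops.\<close>
      then have "card ((#>) H ` insert g P) = Suc (card P)"
        using card_image finP gP by fastforce
      moreover have "card ((#>) H ` insert g P) \<le> card (rcosets H)"
        using sub[of "insert g P"] g(1) P(1) fin by (intro card_mono) auto
      ultimately show "card (rcosets H) - card (insert g P) < card (rcosets H) - card P"
        using finP gP by simp
      have "Suc (card (inner_edges S P)) = card (insert e (inner_edges S P))"
        using e(1) finite_inner_edges[OF S(1) finP] by simp
      also have "\<dots> \<le> card (inner_edges S (insert g P))"
        using e(2) finite_inner_edges[OF S(1), of "insert g P"] finP
        by (intro card_mono) (auto simp: inner_edges_def)
      finally show "card (insert g P) \<le> card (inner_edges S (insert g P))"
        using P(4) gP finP by simp
    qed (use less.prems g in auto)
    have "\<exists>p\<in>P. \<exists>s\<in>S. H #> (p \<otimes> s) \<notin> (#>) H ` P \<or> H #> (p \<otimes> inv s) \<notin> (#>) H ` P"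
    proof (rule ccontr)
      assume "\<not> ?thesis"
      then have closed: "H #> (p \<otimes> s) \<in> (#>) H ` P" "H #> (p \<otimes> inv s) \<in> (#>) H ` P"
        if "p \<in> P" "s \<in> S" for p s using that by auto
      \<comment> \<open>The union of the cosets met by \<open>P\<close>. If no edge leaves it, right
        multiplication by \<open>G\<close> preserves it, and \<open>inv p \<otimes> g\<close>
        carries \<open>p\<close> to an arbitrary \<open>g\<close>.\<close>
      let ?A = "{g \<in> carrier G. H #> g \<in> (#>) H ` P}"
      have A: "a \<otimes> g \<in> ?A" if "g \<in> generate G S" "a \<in> ?A" for g a
      proof (rule generate_closed_right[OF S(2) _ _ _ that])
        fix a s assume a: "a \<in> ?A" and s: "s \<in> S"
        then obtain p where p: "p \<in> P" "H #> a = H #> p" by blast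
        have c: "a \<in> carrier G" "p \<in> carrier G" "s \<in> carrier G"
          using a p s P(1) S(2) by auto
        show "a \<otimes> s \<in> ?A" "a \<otimes> inv s \<in> ?A"
          using closed[OF p(1) s] rcos_mult_right[OF H c(1,2) _ p(2)] c by auto
      qed auto
      obtain p where p: "p \<in> P" "p \<in> carrier G" using P by blast
      have "rcosets H \<subseteq> (#>) H ` P"
      proof
        fix Z assume "Z \<in> rcosets H"
        then obtain g where g: "g \<in> carrier G" "Z = H #> g" by (auto simp: RCOSETS_def)
        have "p \<otimes> (inv p \<otimes> g) \<in> ?A" using A[of "inv p \<otimes> g" p] g p S(3) by auto
        then show "Z \<in> (#>) H ` P" using g p by (simp add: m_assoc[symmetric])
      qed
      then show False using False sub[OF P(1)] by blast
    qed
    then obtain p s where ps: "p \<in> P" "s \<in> S" "p \<in> carrier G" "s \<in> carrier G"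
      and "H #> (p \<otimes> s) \<notin> (#>) H ` P \<or> H #> (p \<otimes> inv s) \<notin> (#>) H ` P"
      using P(1) S(2) by blast
    then consider "H #> (p \<otimes> s) \<notin> (#>) H ` P" | "H #> (p \<otimes> inv s) \<notin> (#>) H ` P" by blast
    then show ?thesis
    proof cases
      case 1
      show ?thesis
        by (rule grow[of "p \<otimes> s" "(p, s)"]) (use 1 ps in \<open>auto simp: inner_edges_def\<close>)
    next
      case 2
      \<comment> \<open>Read forwards, the added edge starts at the new vertex and ends at
        \<open>p\<close>.\<close>
      show ?thesis
        by (rule grow[of "p \<otimes> inv s" "(p \<otimes> inv s, s)"])
          (use 2 ps in \<open>auto simp: inner_edges_def m_assoc\<close>)
    qed
  qed
qed

section \<open>Rank of a subgroup of finite index\<close>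

lemma grp_rank_le:
  assumes "finite S" "S \<subseteq> H" "generate G S = H"
  shows "grp_rank G H \<le> card S"
  unfolding grp_rank_def by (rule Least_le) (use assms in blast)

text \<open>Once \<open>P\<close> is extended to a transversal, at least \<open>d\<close> of the
  \<open>d * card S\<close> Schreier generators drop out, where \<open>d\<close> is the index.
  Stating the bound as a sum avoids truncated subtraction.\<close>

lemma (in group) grp_rank_le_of_cycle:
  assumes H: "subgroup H G" and fin: "finite (rcosets H)"
    and S: "finite S" "S \<subseteq> carrier G" "generate G S = carrier G"
    and P: "P \<subseteq> carrier G" "\<one> \<in> P" "inj_on ((#>) H) P" "card P \<le> card (inner_edges S P)"
  shows "grp_rank G H + card (rcosets H) \<le> card (rcosets H) * card S"
proof -
  obtain Q where Q: "P \<subseteq> Q" "Q \<subseteq> carrier G" "inj_on ((#>) H) Q" "(#>) H ` Q = rcosets H"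
    "card Q \<le> card (inner_edges S Q)"
    using extend_partial_transversal[OF H fin S P(1) _ P(3,4)] P(2) by blast
  have cardQ: "card Q = card (rcosets H)" using Q(3,4) card_image by metis
  have finQ: "finite Q" using Q(3,4) fin by (metis finite_imageD)
  \<comment> \<open>The representative depends on \<open>g\<close> only through its coset, as
    \<open>schreier_generators\<close> demands.\<close>
  define r where "r g = inv_into Q ((#>) H) (H #> g)" for g
  have r: "r g \<in> Q \<and> H #> r g = H #> g" if "g \<in> carrier G" for g
  proof -
    have "H #> g \<in> (#>) H ` Q" using that Q(4) by (auto simp: RCOSETS_def)
    then show ?thesis unfolding r_def by (metis f_inv_into_f inv_into_into)
  qed
  have r_id: "r p = p" if "p \<in> Q" for p unfolding r_def using that Q(3) by simp
  let ?E = "Q \<times> S - inner_edges S Q"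
  let ?T = "(\<lambda>(p, s). p \<otimes> s \<otimes> inv (r (p \<otimes> s))) ` ?E"
  have gen: "generate G ?T = H"
    by (rule schreier_generators[OF H S(2,3) Q(2)]) (use r r_id P Q in \<open>auto simp: r_def\<close>)
  have "?T \<subseteq> H" using gen generate.incl[of _ ?T G] by blast
  then have "grp_rank G H \<le> card ?T" using finQ S(1) gen by (intro grp_rank_le) auto
  also have "\<dots> \<le> card ?E" using finQ S(1) by (intro card_image_le) auto
  also have "\<dots> = card Q * card S - card (inner_edges S Q)"
    using finQ S(1) finite_inner_edges[of S Q]
    by (subst card_Diff_subset) (auto simp: inner_edges_def)
  finally have "grp_rank G H \<le> card Q * card S - card (inner_edges S Q)" .
  \<comment> \<open>This makes the subtraction above exact instead of truncated at 0.\<close>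
  moreover have "card (inner_edges S Q) \<le> card (Q \<times> S)"
    using finQ S(1) by (intro card_mono) (auto simp: inner_edges_def)
  ultimately show ?thesis using Q(5) cardQ by (simp add: card_cartesian_product)
qed

section \<open>Separating finite sets by subgroups of finite index\<close>

lemma (in group) r_coset_Int:
  assumes "A \<subseteq> carrier G" "B \<subseteq> carrier G" "x \<in> carrier G"
  shows "(A \<inter> B) #> x = (A #> x) \<inter> (B #> x)"
proof -
  have "a = b" if "a \<in> A" "b \<in> B" "a \<otimes> x = b \<otimes> x" for a b
    using that assms by (meson r_cancel subsetD)
  then show ?thesis by (fastforce simp: r_coset_def)
qed

text \<open>A coset of the intersection is the intersection of a coset of \<open>A\<close> with one
  of \<open>B\<close>, and there are finitely many such pairs.\<close>

lemma (in group) finite_rcosets_Int: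
  assumes "A \<subseteq> carrier G" "B \<subseteq> carrier G" "finite (rcosets A)" "finite (rcosets B)"
  shows "finite (rcosets (A \<inter> B))"
proof -
  have "rcosets (A \<inter> B) \<subseteq> (\<lambda>(Y, Z). Y \<inter> Z) ` ((rcosets A) \<times> (rcosets B))"
    using r_coset_Int[OF assms(1,2)] by (force simp: RCOSETS_def)
  then show ?thesis using assms(3,4) by (meson finite_SigmaI finite_imageI finite_subset)
qed

text \<open>Residual finiteness deals with one element at a time; intersecting the resulting
  subgroups keeps the index finite.\<close>

lemma (in group) residually_finite_avoid:
  assumes rf: "residually_finite G" and "finite Z" "Z \<subseteq> carrier G" "\<one> \<notin> Z"
  obtains H where "subgroup H G" "finite (rcosets H)" "H \<inter> Z = {}"
  using assms(2-)
proof (induction Z arbitrary: thesis rule: finite_induct)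
  case empty
  \<comment> \<open>With nothing to avoid, the whole group serves, having a single coset.\<close>
  have "rcosets (carrier G) \<subseteq> {carrier G}"
    using coset_join2[OF _ subgroup_self] by (auto simp: RCOSETS_def)
  then show ?case using empty subgroup_self by (meson finite.intros finite_subset inf_bot_right)
next
  case (insert x Z)
  obtain H where H: "subgroup H G" "finite (rcosets H)" "H \<inter> Z = {}"
    using insert by blast
  obtain N where N: "N \<lhd> G" "fin_index G N" "x \<notin> N"
    using rf insert.prems unfolding residually_finite_def by (metis insert_subset insertI1)
  have "subgroup N G" using N(1) by (rule normal_imp_subgroup)
  show ?case
  proof (rule insert.prems(1))
    show "subgroup (H \<inter> N) G" by (rule subgroups_Inter_pair[OF H(1) \<open>subgroup N G\<close>])
    show "finite (rcosets (H \<inter> N))"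
      using H N \<open>subgroup N G\<close>
      by (intro finite_rcosets_Int) (auto simp: fin_index_def subgroup.subset)
    show "(H \<inter> N) \<inter> insert x Z = {}" using H N by auto
  qed
qed

section \<open>Shortest relators\<close>

text \<open>In terms of positions it is plain that contiguous subwords of reduced words are
  reduced.\<close>

lemma reduced_word_iff:
  "reduced_word w \<longleftrightarrow>
     (\<forall>i. Suc i < length w \<longrightarrow> \<not> (fst (w ! i) = fst (w ! Suc i) \<and> snd (w ! i) \<noteq> snd (w ! Suc i)))"
proof (induction w rule: reduced_word.induct)
  case (3 x b y c w)
  then show ?case by (auto simp: All_less_Suc2)
qed auto

lemma (in group) eval_word_closed:
  "fst ` set w \<subseteq> carrier G \<Longrightarrow> eval_word G w \<in> carrier G"
proof (induction w)
  case (Cons a w)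
  obtain x b where "a = (x, b)" by fastforce
  then show ?case using Cons by (cases b) auto
qed simp

lemma (in group) eval_word_append:
  "fst ` set u \<subseteq> carrier G \<Longrightarrow> fst ` set v \<subseteq> carrier G \<Longrightarrow>
    eval_word G (u @ v) = eval_word G u \<otimes> eval_word G v"
proof (induction u)
  case (Cons a u)
  obtain x b where "a = (x, b)" by fastforce
  then show ?case using Cons eval_word_closed by (cases b) (auto simp: m_assoc)
qed (simp add: eval_word_closed)

text \<open>The path through the values of the prefixes of \<open>w\<close> meets a vertex twice
  only on closing up, since the segment between two equal values would be a shorter relator. Its
  letters therefore traverse \<open>length w\<close> distinct edges on at most
  \<open>length w\<close> vertices.\<close>

lemma (in group) shortest_relator_cycle:
  assumes S: "S \<subseteq> carrier G" "finite S"
    and w: "w \<noteq> []" "fst ` set w \<subseteq> S" "reduced_word w" "eval_word G w = \<one>"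
    and shortest: "\<And>v. v \<noteq> [] \<Longrightarrow> fst ` set v \<subseteq> S \<Longrightarrow> reduced_word v \<Longrightarrow> eval_word G v = \<one> \<Longrightarrow>
      length w \<le> length v"
  obtains P where "finite P" "P \<subseteq> carrier G" "\<one> \<in> P" "card P \<le> card (inner_edges S P)"
proof -
  define m where "m = length w"
  define p where "p i = eval_word G (take i w)" for i
  have m: "m > 0" using w(1) by (simp add: m_def)
  have p0: "p 0 = \<one>" and pm: "p m = \<one>" using w(4) by (simp_all add: p_def m_def)
  have wc: "fst ` set w \<subseteq> carrier G" using w(2) S by blast
  have tc: "fst ` set (take i w) \<subseteq> carrier G" for i using wc set_take_subset by fastforce
  have pc: "p i \<in> carrier G" for i unfolding p_def using tc by (rule eval_word_closed)
  \<comment> \<open>The subword between the two positions would be a shorter reduced relator. The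
    bound \<open>j - i < m\<close> exempts only the pair 0 and \<open>m\<close>, where the path
    closes.\<close>
  have p_neq: "p i \<noteq> p j" if "i < j" "j - i < m" "j \<le> m" for i j
  proof
    assume eq: "p i = p j"
    let ?v = "drop i (take j w)"
    have vset: "set ?v \<subseteq> set w" by (meson order_trans set_drop_subset set_take_subset)
    have len: "length ?v = j - i" using that by (simp add: m_def)
    have "take j w = take i w @ ?v"
      using that by (metis append_take_drop_id min.absorb1 less_imp_le take_take)
    then have "p j = p i \<otimes> eval_word G ?v"
      using eval_word_append[OF tc, of ?v i] vset wc unfolding p_def by fastforce
    moreover have "eval_word G ?v \<in> carrier G"
      by (rule eval_word_closed) (use vset wc in blast)
    ultimately have "eval_word G ?v = \<one>" using eq pc by (metis l_cancel_one')
    moreover have "reduced_word ?v"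
      using w(3) that unfolding reduced_word_iff by (auto simp: m_def)
    moreover have "?v \<noteq> []" using len that by force
    moreover have "fst ` set ?v \<subseteq> S" using vset w(2) by blast
    ultimately have "m \<le> length ?v" using shortest unfolding m_def by blast
    then show False using len that by simp
  qed
  have p_inj: "i = j \<or> (i = 0 \<and> j = m) \<or> (i = m \<and> j = 0)"
    if "p i = p j" "i \<le> m" "j \<le> m" for i j
  proof (cases i j rule: linorder_cases)
    case less
    then show ?thesis using p_neq[of i j] that by (cases "j - i < m") auto
  next
    case greater
    then show ?thesis using p_neq[of j i] that by (cases "i - j < m") auto
  qed auto
  have step: "p (Suc i) = p i \<otimes> (if snd (w ! i) then inv (fst (w ! i)) else fst (w ! i))"
    and wi: "fst (w ! i) \<in> carrier G" "fst (w ! i) \<in> S" if "i < m" for i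
  proof -
    have "w ! i \<in> set w" using that by (simp add: m_def)
    then show c: "fst (w ! i) \<in> carrier G" "fst (w ! i) \<in> S" using wc w(2) by auto
    have "take (Suc i) w = take i w @ [w ! i]"
      using that by (simp add: m_def take_Suc_conv_app_nth)
    moreover have "eval_word G [w ! i] = (if snd (w ! i) then inv (fst (w ! i)) else fst (w ! i))"
      using c by (cases "w ! i"; cases "snd (w ! i)") auto
    ultimately show "p (Suc i) = p i \<otimes> (if snd (w ! i) then inv (fst (w ! i)) else fst (w ! i))"
      using eval_word_append[OF tc, of "[w ! i]" i] c unfolding p_def by simp
  qed
  define P where "P = p ` {..<m}"
  \<comment> \<open>A letter \<open>(x, True)\<close> walks an edge backwards, so the source of that
    edge is the later vertex.\<close>
  define e where "e i = (if snd (w ! i) then p (Suc i) else p i, fst (w ! i))" for i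
  have pP: "p i \<in> P" if "i \<le> m" for i
    using that m p0 pm unfolding P_def by (cases "i = m") (metis imageI lessThan_iff, auto)
  have "e i \<in> inner_edges S P" if "i < m" for i
    using step[OF that] wi[OF that] pc pP[of i] pP[of "Suc i"] that
    by (auto simp: e_def inner_edges_def m_assoc)
  then have e_sub: "e ` {..<m} \<subseteq> inner_edges S P" by blast
  have red: "snd (w ! i) = snd (w ! Suc i)" if "Suc i < m" "fst (w ! i) = fst (w ! Suc i)" for i
    using w(3) that unfolding reduced_word_iff m_def by blast
  \<comment> \<open>An edge walked twice in one direction repeats a vertex; walked in both
    directions it forces two adjacent letters to cancel.\<close>
  have e_neq: "e i \<noteq> e j" if ij: "i < j" "j < m" for i j
  proof
    assume eq: "e i = e j"
    then have x: "fst (w ! i) = fst (w ! j)" by (simp add: e_def)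
    consider "snd (w ! i) = snd (w ! j)" | "snd (w ! i)" "\<not> snd (w ! j)"
      | "\<not> snd (w ! i)" "snd (w ! j)" by blast
    then show False
    proof cases
      case 1
      then have "p i = p j \<or> p (Suc i) = p (Suc j)" using eq by (auto simp: e_def split: if_splits)
      then show False using p_neq[of i j] p_neq[of "Suc i" "Suc j"] ij by auto
    next
      case 2
      then have "p (Suc i) = p j" using eq by (simp add: e_def)
      then have "j = Suc i" using p_inj[of "Suc i" j] ij by auto
      then show False using red[of i] x 2 ij by auto
    next
      case 3
      then have pij: "p i = p (Suc j)" using eq by (simp add: e_def)
      \<comment> \<open>The first and last letters are inverse to each other, which
        \<open>reduced_word\<close> does not exclude. But then \<open>p 1\<close> equals
        \<open>p j\<close>, so \<open>j\<close> is 1 and the two letters are adjacent after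
        all.\<close>
      then have b: "i = 0" "Suc j = m" using p_inj[of i "Suc j"] ij by auto
      have "p (Suc i) = p i \<otimes> fst (w ! i)" using step[of i] ij 3 by simp
      also have "\<dots> = p j"
        using step[of j] wi[of j] ij 3 pij x pc by (simp add: m_assoc)
      finally have "j = Suc i" using p_inj[of "Suc i" j] ij b by auto
      then show False using red[of i] x 3 ij by auto
    qed
  qed
  then have "inj_on e {..<m}" by (metis inj_onI lessThan_iff linorder_neqE_nat)
  then have "card (e ` {..<m}) = m" by (simp add: card_image)
  moreover have "finite P" by (simp add: P_def)
  then have "card (e ` {..<m}) \<le> card (inner_edges S P)"
    using e_sub finite_inner_edges[OF S(2)] by (intro card_mono) auto
  moreover have "card P \<le> m" unfolding P_def using card_image_le[of "{..<m}" p] by simp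
  moreover have "\<one> \<in> P" using pP[of 0] p0 by simp
  ultimately show thesis using that[of P] pc \<open>finite P\<close> by (auto simp: P_def)
qed

section \<open>Freeness on a generating set of minimal size\<close>

theorem theorem1:
  fixes G :: "('a, 'b) monoid_scheme"
  assumes "group G"
    and "fin_gen_group G"
    and "residually_finite G"
    and "\<And>G1 G2. subgroup G1 G \<Longrightarrow> subgroup G2 G \<Longrightarrow> G2 \<subseteq> G1 \<Longrightarrow> fin_index G G2 \<Longrightarrow>
           int (grp_rank G G2) - 1 = int (rel_index G G1 G2) * (int (grp_rank G G1) - 1)"
  shows "free_group G"
proof -
  interpret group G by fact
  have "\<exists>n S. finite S \<and> S \<subseteq> carrier G \<and> card S = n \<and> generate G S = carrier G"
    using assms(2) unfolding fin_gen_group_def by blast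
  then have "\<exists>S. finite S \<and> S \<subseteq> carrier G \<and> card S = grp_rank G (carrier G)
      \<and> generate G S = carrier G"
    unfolding grp_rank_def by (rule LeastI_ex)
  then obtain S where S: "finite S" "S \<subseteq> carrier G" "generate G S = carrier G"
    and cardS: "card S = grp_rank G (carrier G)" by blast
  have "free_basis G S"
  proof (rule ccontr)
    let ?R = "\<lambda>w. w \<noteq> [] \<and> fst ` set w \<subseteq> S \<and> reduced_word w \<and> eval_word G w = \<one>\<^bsub>G\<^esub>"
    assume "\<not> free_basis G S"
    then have "\<exists>w. ?R w" using S unfolding free_basis_def by auto
    then obtain u where "?R u" ..
    define w where "w = arg_min length ?R"
    have w: "?R w" and shortest: "length w \<le> length v" if "?R v" for v
      using arg_min_nat_lemma[of ?R u length] \<open>?R u\<close> that unfolding w_def by blast+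
    obtain P where P: "finite P" "P \<subseteq> carrier G" "\<one>\<^bsub>G\<^esub> \<in> P" "card P \<le> card (inner_edges S P)"
      by (rule shortest_relator_cycle[OF S(2,1), of w])
        (use w[OF \<open>?R u\<close>] shortest in simp_all)
    \<comment> \<open>The cosets of \<open>x\<close> and \<open>y\<close> agree iff
      \<open>x \<otimes> inv y\<close> lies in the subgroup, so a subgroup that misses this finite
      set keeps the points of \<open>P\<close> apart.\<close>
    let ?X = "{x \<otimes>\<^bsub>G\<^esub> inv\<^bsub>G\<^esub> y |x y. x \<in> P \<and> y \<in> P \<and> x \<noteq> y}"
    have "?X \<subseteq> (\<lambda>(x, y). x \<otimes>\<^bsub>G\<^esub> inv\<^bsub>G\<^esub> y) ` (P \<times> P)" by auto
    then have "finite ?X" using P(1) by (meson finite_SigmaI finite_imageI finite_subset)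
    moreover have "?X \<subseteq> carrier G" using P(2) by auto
    moreover have "\<one>\<^bsub>G\<^esub> \<notin> ?X"
    proof
      assume "\<one>\<^bsub>G\<^esub> \<in> ?X"
      then obtain x y where xy: "x \<in> P" "y \<in> P" "x \<noteq> y" "x \<otimes>\<^bsub>G\<^esub> inv\<^bsub>G\<^esub> y = \<one>\<^bsub>G\<^esub>" by auto
      then have "x = y" using P(2) by (metis inv_closed inv_equality inv_inv subsetD)
      then show False using xy by simp
    qed
    ultimately obtain H where H: "subgroup H G" "finite (rcosets\<^bsub>G\<^esub> H)" "H \<inter> ?X = {}"
      by (rule residually_finite_avoid[OF assms(3)])
    have "inj_on ((#>\<^bsub>G\<^esub>) H) P"
    proof (rule inj_onI, rule ccontr)
      fix x y assume xy: "x \<in> P" "y \<in> P" "H #>\<^bsub>G\<^esub> x = H #>\<^bsub>G\<^esub> y" "x \<noteq> y"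
      then have "x \<otimes>\<^bsub>G\<^esub> inv\<^bsub>G\<^esub> y \<in> H" using rcos_eq_iff[OF H(1)] P(2) by blast
      then show False using xy H(3) by blast
    qed
    then have le: "grp_rank G H + card (rcosets\<^bsub>G\<^esub> H) \<le> card (rcosets\<^bsub>G\<^esub> H) * card S"
      using grp_rank_le_of_cycle[OF H(1,2) S P(2,3) _ P(4)] by blast
    \<comment> \<open>Here the minimality of \<open>S\<close> enters: \<open>card S\<close> is the
      rank of \<open>G\<close>. With index \<open>d\<close> and \<open>n = card S\<close>, the rank
      of \<open>H\<close> is \<open>d * n - d + 1\<close>, one more than \<open>le\<close>
      allows.\<close>
    have "int (grp_rank G H) - 1 = int (card (rcosets\<^bsub>G\<^esub> H)) * (int (card S) - 1)"
      using assms(4)[OF subgroup_self H(1) subgroup.subset[OF H(1)]] H(2) cardS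
      by (simp add: fin_index_def rel_index_def)
    moreover have "int (grp_rank G H) + int (card (rcosets\<^bsub>G\<^esub> H)) \<le> int (card (rcosets\<^bsub>G\<^esub> H)) * int (card S)"
      using le by (metis of_nat_add of_nat_le_iff of_nat_mult)
    ultimately show False by (simp add: algebra_simps)
  qed
  then show ?thesis unfolding free_group_def by blast
qed

end
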